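(* Let $\psi:\mathbb{R}^d\to(-\infty,\infty]$ be proper, closed, convex, bounded below with $\int e^{-\psi}<\infty$, $\pi\propto e^{-\psi}$, and for fixed $\lambda>0$ let $\pi^\lambda\propto e^{-\psi^\lambda}$ and $w^\lambda(x)=e^{-\{\psi(x)-\psi^\lambda(x)\}}$. Let $\xi:\mathbb{R}^d\to\mathbb{R}^p$ with $\theta=\mathbb{E}_\pi[\xi(X)]$ finite, and let $\{X_t\}_{t\ge1}$ be an irreducible, aperiodic, Harris recurrent Markov chain with stationary density $\pi^\lambda$ for which the matrix $$\Xi=\frac{1}{[\mathbb{E}_{\pi^\lambda}(w^\lambda(X_1))]^2}\begin{bmatrix}\mathbf I_p&-\theta\end{bmatrix}\Sigma\begin{bmatrix}\mathbf I_p\\-\theta^T\end{bmatrix},\quad \Sigma=\sum_{k=-\infty}^\infty\mathrm{Cov}_{\pi^\lambda}(S(X_1),S(X_{1+k})),\quad S(x)=\begin{pmatrix}\xi(x)w^\lambda(x)\\ w^\lambda(x)\end{pmatrix},$$ is well defined. Let $\hat\Sigma$ be an estimator of $\Sigma$ computed from $X_1,\dots,X_n$ that is strongly consistent, i.e. $\hat\Sigma\to\Sigma$ almost surely as $n\to\infty$, and define $$\hat\Xi_n=\frac{1}{\bar w_n^2}\begin{bmatrix}\mathbf I_p&-\hat\theta_n^{\mathrm{MY}}\end{bmatrix}\hat\Sigma\begin{bmatrix}\mathbf I_p\\-(\hat\theta_n^{\mathrm{MY}})^T\end{bmatrix},$$ where $\bar w_n=n^{-1}\sum_{t=1}^n w^\lambda(X_t)$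 and $\hat\theta_n^{\mathrm{MY}}=\sum_{t=1}^n\xi(X_t)w^\lambda(X_t)/\sum_{k=1}^n w^\lambda(X_k)$. Then $\hat\Xi_n\to\Xi$ almost surely as $n\to\infty$.
   Context: $\psi^\lambda(x)=\inf_y\{\psi(y)+\frac1{2\lambda}\|y-x\|^2\}$ is the Moreau-Yosida envelope of $\psi$; $\mathrm{Cov}_{\pi^\lambda}$ is covariance along the stationary chain. *)

theory Defs
  imports "HOL-Probability.Probability"
begin

definition proper_fun :: "('a \<Rightarrow> ereal) \<Rightarrow> bool" where
  "proper_fun f \<longleftrightarrow> (\<forall>x. f x \<noteq> -\<infinity>) \<and> (\<exists>x. f x \<noteq> \<infinity>)"

definition epigraph_e :: "('a \<Rightarrow> ereal) \<Rightarrow> ('a \<times> real) set" where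
  "epigraph_e f = {(x, t). f x \<le> ereal t}"

definition closed_fun :: "('a::topological_space \<Rightarrow> ereal) \<Rightarrow> bool" where
  "closed_fun f \<longleftrightarrow> closed (epigraph_e f)"

definition convex_fun :: "('a::real_vector \<Rightarrow> ereal) \<Rightarrow> bool" where
  "convex_fun f \<longleftrightarrow> convex (epigraph_e f)"

definition bounded_below_fun :: "('a \<Rightarrow> ereal) \<Rightarrow> bool" where
  "bounded_below_fun f \<longleftrightarrow> (\<exists>c::real. \<forall>x. ereal c \<le> f x)"

definition MY_env :: "('a::real_normed_vector \<Rightarrow> ereal) \<Rightarrow> real \<Rightarrow> 'a \<Rightarrow> ereal" where
  "MY_env f lam x = (INF y. f y + ereal ((norm (y - x))\<^sup>2 / (2 * lam)))"

definition neg_exp :: "('a \<Rightarrow> ereal) \<Rightarrow> 'a \<Rightarrow> real" where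
  "neg_exp f x = (if f x = \<infinity> then 0 else exp (- real_of_ereal (f x)))"

definition norm_const :: "('a::euclidean_space \<Rightarrow> ereal) \<Rightarrow> real" where
  "norm_const f = enn2real (\<integral>\<^sup>+ x. ennreal (neg_exp f x) \<partial>lborel)"

definition gibbs :: "('a::euclidean_space \<Rightarrow> ereal) \<Rightarrow> 'a measure" where
  "gibbs f = density lborel (\<lambda>x. ennreal (neg_exp f x / norm_const f))"

definition w_MY :: "('a::real_normed_vector \<Rightarrow> ereal) \<Rightarrow> real \<Rightarrow> 'a \<Rightarrow> real" where
  "w_MY f lam x = (if f x = \<infinity> then 0
      else exp (- (real_of_ereal (f x) - real_of_ereal (MY_env f lam x))))"

primrec kpow :: "('a::topological_space \<Rightarrow> 'a measure) \<Rightarrow> nat \<Rightarrow> 'a \<Rightarrow> 'a measure" where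
  "kpow K 0 = (\<lambda>x. return borel x)"
| "kpow K (Suc n) = (\<lambda>x. kpow K n x \<bind> K)"

text \<open>\<open>hit_le K A n x = P_x(X_t \<in> A for some 1 \<le> t \<le> n)\<close>\<close>
primrec hit_le :: "('a \<Rightarrow> 'a measure) \<Rightarrow> 'a set \<Rightarrow> nat \<Rightarrow> 'a \<Rightarrow> ennreal" where
  "hit_le K A 0 = (\<lambda>x. 0)"
| "hit_le K A (Suc n) = (\<lambda>x. \<integral>\<^sup>+ y. (if y \<in> A then 1 else hit_le K A n y) \<partial>K x)"

definition L_hit :: "('a \<Rightarrow> 'a measure) \<Rightarrow> 'a set \<Rightarrow> 'a \<Rightarrow> ennreal" where
  "L_hit K A x = (SUP n. hit_le K A n x)"

text \<open>\<open>Q(x,A) = P_x(X_t \<in> A infinitely often)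
   = lim_N P_x(X_t \<in> A for some t > N) = inf_N \<integral> L(y,A) K^N(x,dy)\<close>\<close>
definition io_prob :: "('a::topological_space \<Rightarrow> 'a measure) \<Rightarrow> 'a set \<Rightarrow> 'a \<Rightarrow> ennreal" where
  "io_prob K A x = (INF N. \<integral>\<^sup>+ y. L_hit K A y \<partial>kpow K N x)"

definition markov_kernel :: "('a::topological_space \<Rightarrow> 'a measure) \<Rightarrow> bool" where
  "markov_kernel K \<longleftrightarrow> K \<in> borel \<rightarrow>\<^sub>M prob_algebra borel"

definition irred_measure :: "('a::topological_space \<Rightarrow> 'a measure) \<Rightarrow> 'a measure \<Rightarrow> bool" where
  "irred_measure K \<phi> \<longleftrightarrow> sets \<phi> = sets borel \<and> sigma_finite_measure \<phi> \<and> emeasure \<phi> UNIV \<noteq> 0 \<and>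
     (\<forall>A\<in>sets borel. emeasure \<phi> A > 0 \<longrightarrow> (\<forall>x. L_hit K A x > 0))"

definition irreducible_kernel :: "('a::topological_space \<Rightarrow> 'a measure) \<Rightarrow> bool" where
  "irreducible_kernel K \<longleftrightarrow> (\<exists>\<phi>. irred_measure K \<phi>)"

text \<open>\<open>A \<in> B^+\<close>: positive for the maximal irreducibility measure
  \<open>\<psi>(A) = \<integral> \<phi>(dy) \<Sum>_n 2^{-n-1} K^n(y,A)\<close> (Meyn-Tweedie Prop. 4.2.2), i.e. \<open>\<psi>(A) > 0\<close> iff
  \<open>\<phi>{y. \<exists>n. K^n(y,A) > 0} > 0\<close>\<close>
definition psi_pos :: "('a::topological_space \<Rightarrow> 'a measure) \<Rightarrow> 'a measure \<Rightarrow> 'a set \<Rightarrow> bool" where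
  "psi_pos K \<phi> A \<longleftrightarrow> emeasure \<phi> {y. \<exists>n. emeasure (kpow K n y) A > 0} > 0"

definition harris_recurrent :: "('a::topological_space \<Rightarrow> 'a measure) \<Rightarrow> bool" where
  "harris_recurrent K \<longleftrightarrow> (\<exists>\<phi>. irred_measure K \<phi> \<and>
     (\<forall>A\<in>sets borel. psi_pos K \<phi> A \<longrightarrow> (\<forall>x. io_prob K A x = 1)))"

text \<open>aperiodic: there is no d-cycle with d \<ge> 2 (Meyn-Tweedie Sec. 5.4)\<close>
definition aperiodic_kernel :: "('a::topological_space \<Rightarrow> 'a measure) \<Rightarrow> bool" where
  "aperiodic_kernel K \<longleftrightarrow> (\<exists>\<phi>. irred_measure K \<phi> \<and>
     \<not> (\<exists>d::nat. d \<ge> 2 \<and> (\<exists>D::nat \<Rightarrow> 'a set.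
          (\<forall>i<d. D i \<in> sets borel) \<and> disjoint_family_on D {..<d} \<and>
          (\<forall>i<d. \<forall>x\<in>D i. emeasure (K x) (D (Suc i mod d)) = 1) \<and>
          \<not> psi_pos K \<phi> (UNIV - (\<Union>i<d. D i)))))"

definition nat_filtr :: "'w measure \<Rightarrow> (nat \<Rightarrow> 'w \<Rightarrow> 'a::topological_space) \<Rightarrow> nat \<Rightarrow> 'w measure" where
  "nat_filtr M X n = sigma (space M) {X t -` A \<inter> space M | t A. t \<in> {1..n} \<and> A \<in> sets borel}"

text \<open>\<open>(X_t)_{t\<ge>1}\<close> is a Markov chain with transition kernel K (arbitrary initial law)\<close>
definition markov_chain :: "'w measure \<Rightarrow> ('a::topological_space \<Rightarrow> 'a measure) \<Rightarrow> (nat \<Rightarrow> 'w \<Rightarrow> 'a) \<Rightarrow> bool" where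
  "markov_chain M K X \<longleftrightarrow> prob_space M \<and> markov_kernel K \<and> (\<forall>t. X t \<in> M \<rightarrow>\<^sub>M borel) \<and>
     (\<forall>n\<ge>1. \<forall>A\<in>sets borel. AE \<omega> in M.
        real_cond_exp M (nat_filtr M X n) (\<lambda>\<omega>. indicator A (X (Suc n) \<omega>)) \<omega> = measure (K (X n \<omega>)) A)"

definition S_vec :: "('a \<Rightarrow> real^'p) \<Rightarrow> ('a \<Rightarrow> real) \<Rightarrow> 'a \<Rightarrow> real^('p + unit)" where
  "S_vec \<xi> w x = (\<chi> i. case i of Inl j \<Rightarrow> \<xi> x $ j * w x | Inr _ \<Rightarrow> w x)"

text \<open>\<open>Cov_\<mu>(S(X_1), S(X_{1+k}))\<close>, \<open>k \<ge> 0\<close>, along the stationary chain with kernel K\<close>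
definition lag_cov :: "'a::topological_space measure \<Rightarrow> ('a \<Rightarrow> 'a measure) \<Rightarrow> ('a \<Rightarrow> real^'q) \<Rightarrow> nat \<Rightarrow> real^'q^'q" where
  "lag_cov \<mu> K S k = (\<chi> i j. (\<integral>x. S x $ i * (\<integral>y. S y $ j \<partial>kpow K k x) \<partial>\<mu>)
                        - (\<integral>x. S x $ i \<partial>\<mu>) * (\<integral>x. S x $ j \<partial>\<mu>))"

text \<open>\<open>\<Sigma> = \<Sum>_{k=-\<infinity>}^{\<infinity>} Cov(S(X_1),S(X_{1+k}))\<close>, using \<open>Cov at lag -k = (Cov at lag k)^T\<close>\<close>
definition Sigma_mat :: "'a::topological_space measure \<Rightarrow> ('a \<Rightarrow> 'a measure) \<Rightarrow> ('a \<Rightarrow> real^'q) \<Rightarrow> real^'q^'q" where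
  "Sigma_mat \<mu> K S = lag_cov \<mu> K S 0 + (\<Sum>k. lag_cov \<mu> K S (Suc k))
                       + transpose (\<Sum>k. lag_cov \<mu> K S (Suc k))"

definition B_mat :: "real^'p \<Rightarrow> real^('p + unit)^'p" where
  "B_mat \<theta> = (\<chi> i j. case j of Inl l \<Rightarrow> (if l = i then 1 else 0) | Inr _ \<Rightarrow> - \<theta> $ i)"

definition Xi_mat :: "real \<Rightarrow> real^'p \<Rightarrow> real^('p + unit)^('p + unit) \<Rightarrow> real^'p^'p" where
  "Xi_mat m \<theta> \<Sigma> = (1 / m\<^sup>2) *\<^sub>R (B_mat \<theta> ** \<Sigma> ** transpose (B_mat \<theta>))"

definition Xi_well_defined :: "'a::topological_space measure \<Rightarrow> ('a \<Rightarrow> 'a measure) \<Rightarrow> ('a \<Rightarrow> real^'q) \<Rightarrow> ('a \<Rightarrow> real) \<Rightarrow> bool" where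
  "Xi_well_defined \<mu> K S w \<longleftrightarrow> integrable \<mu> w \<and> (\<integral>x. w x \<partial>\<mu>) \<noteq> 0 \<and>
     (\<forall>i. integrable \<mu> (\<lambda>x. (S x $ i)\<^sup>2)) \<and> summable (\<lambda>k. lag_cov \<mu> K S (Suc k))"

end

theory Submission
  imports Defs
begin

text \<open>
  The heart of the matter is the strong law of large numbers for a Harris recurrent chain with
  invariant probability \<open>\<mu>\<close> and arbitrary initial law. It suffices that the partial sums \<open>S\<^sub>n\<close> of a
  reward \<open>g\<close> with \<open>\<integral>g d\<mu> < 0\<close> are almost surely bounded above (apply this to \<open>\<plusminus>(f - \<integral>f d\<mu>) - \<epsilon>\<close>).
  The function \<open>h(x) = P\<^sub>x(sup S\<^sub>n = \<infinity>)\<close> is bounded and harmonic. By Harris recurrence every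
  trajectory hits \<open>{h = 0}\<close>, so that \<open>h\<close> vanishes identically, or every trajectory hits some
  \<open>{h > \<epsilon>}\<close>, so that \<open>h \<ge> \<epsilon>\<close> everywhere; the latter forces \<open>P\<^sub>x(sup S\<^sub>n > t) = 1\<close> for all \<open>x\<close> and
  \<open>t\<close>, and then the maximal ergodic inequality gives \<open>\<integral>g d\<mu> \<ge> 0\<close>. All path probabilities are
  iterated kernel integrals, so no path space is needed.

  Importance weighting satisfies \<open>exp(-\<psi>\<^sup>\<lambda>) w\<^sup>\<lambda> = exp(-\<psi>)\<close>; hence the ergodic averages of \<open>w\<^sup>\<lambda>\<close> and
  \<open>\<xi> w\<^sup>\<lambda>\<close> identify the limits of the plug-in quantities, and continuity concludes.
\<close>

section \<open>Rewards along a Markov kernel\<close>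

locale markov_reward =
  fixes K :: "'a::topological_space \<Rightarrow> 'a measure" and g :: "'a \<Rightarrow> real"
  assumes kernel: "markov_kernel K" and reward_measurable [measurable]: "g \<in> borel_measurable borel"
begin

lemma kernel_subprob [measurable]: "K \<in> borel \<rightarrow>\<^sub>M subprob_algebra borel"
  using kernel unfolding markov_kernel_def by (rule measurable_prob_algebraD)

lemma prob_space_kernel: "prob_space (K x)"
  using measurable_space[of K borel "prob_algebra borel" x] kernel
  by (auto simp: markov_kernel_def space_prob_algebra)

lemma sets_kernel_borel [measurable_cong, simp]: "sets (K x) = sets borel"
  using sets_kernel[OF kernel_subprob, of x] by simp

lemma space_kernel_UNIV [simp]: "space (K x) = UNIV"
  using sets_eq_imp_space_eq[OF sets_kernel_borel, of x] by simp

lemma emeasure_kernel_UNIV [simp]: "emeasure (K x) UNIV = 1"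
  using prob_space.emeasure_space_1[OF prob_space_kernel, of x] by simp

lemma nn_integral_kernel_measurable [measurable (raw)]:
  assumes "(\<lambda>(x, y). f x y) \<in> borel_measurable (N \<Otimes>\<^sub>M borel)" "h \<in> N \<rightarrow>\<^sub>M borel"
  shows "(\<lambda>x. \<integral>\<^sup>+ y. f x y \<partial>K (h x)) \<in> borel_measurable N"
  by (rule nn_integral_measurable_subprob_algebra2[OF assms(1)]) (use assms(2) in measurable)

subsection \<open>Running maxima\<close>

text \<open>\<open>tail n x t\<close> is \<open>P\<^sub>x(max\<^bsub>0\<le>k\<le>n\<^esub> S\<^sub>k > t)\<close> for \<open>S\<^sub>k = g(X\<^sub>1) + \<dots> + g(X\<^sub>k)\<close>.\<close>

primrec tail :: "nat \<Rightarrow> 'a \<Rightarrow> real \<Rightarrow> ennreal" where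
  "tail 0 = (\<lambda>x t. if t < 0 then 1 else 0)"
| "tail (Suc n) = (\<lambda>x t. if t < 0 then 1 else \<integral>\<^sup>+ y. tail n y (t - g y) \<partial>K x)"

definition tail_sup :: "'a \<Rightarrow> real \<Rightarrow> ennreal" where
  "tail_sup x t = (SUP n. tail n x t)"

text \<open>The probability, starting from \<open>x\<close>, that the partial sums are unbounded
  above. Integer levels keep the infimum countable and, by antitonicity, lose nothing.\<close>

definition unbounded_prob :: "'a \<Rightarrow> ennreal" where
  "unbounded_prob x = (INF m. tail_sup x (real m))"

lemma tail_measurable_pair: "(\<lambda>(x, t). tail n x t) \<in> borel_measurable (borel \<Otimes>\<^sub>M borel)"
proof (induction n)
  case (Suc n)
  have [measurable]: "(\<lambda>z. tail n (f z) (h z)) \<in> borel_measurable N"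
    if "f \<in> N \<rightarrow>\<^sub>M borel" "h \<in> N \<rightarrow>\<^sub>M borel" for f h and N :: "(('a \<times> real) \<times> 'a) measure"
    using measurable_compose[OF measurable_Pair[OF that] Suc] by simp
  show ?case by simp measurable
qed simp

lemma tail_measurable [measurable (raw)]:
  assumes "f \<in> N \<rightarrow>\<^sub>M borel" "h \<in> N \<rightarrow>\<^sub>M borel"
  shows "(\<lambda>z. tail n (f z) (h z)) \<in> borel_measurable N"
  using measurable_compose[OF measurable_Pair[OF assms] tail_measurable_pair] by simp

lemma tail_sup_measurable [measurable (raw)]:
  assumes [measurable]: "f \<in> N \<rightarrow>\<^sub>M borel" "h \<in> N \<rightarrow>\<^sub>M borel"
  shows "(\<lambda>z. tail_sup (f z) (h z)) \<in> borel_measurable N"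
  unfolding tail_sup_def by measurable

lemma unbounded_prob_measurable [measurable]: "unbounded_prob \<in> borel_measurable borel"
  unfolding unbounded_prob_def[abs_def] by measurable

lemma tail_negative: "t < 0 \<Longrightarrow> tail n x t = 1"
  by (cases n) auto

lemma tail_le_one: "tail n x t \<le> 1"
proof (induction n arbitrary: x t)
  case (Suc n)
  have "(\<integral>\<^sup>+ y. tail n y (t - g y) \<partial>K x) \<le> (\<integral>\<^sup>+ y. 1 \<partial>K x)"
    by (intro nn_integral_mono Suc)
  then show ?case by simp
qed simp

lemma tail_le_Suc: "tail n x t \<le> tail (Suc n) x t"
proof (induction n arbitrary: x t)
  case (Suc n)
  have "(\<integral>\<^sup>+ y. tail n y (t - g y) \<partial>K x) \<le> (\<integral>\<^sup>+ y. tail (Suc n) y (t - g y) \<partial>K x)"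
    by (intro nn_integral_mono Suc)
  then show ?case by (simp del: tail.simps(2) add: tail.simps(2)[of n] tail.simps(2)[of "Suc n"])
qed simp

lemma tail_antimono: "s \<le> t \<Longrightarrow> tail n x t \<le> tail n x s"
proof (induction n arbitrary: x s t)
  case (Suc n)
  have "(\<integral>\<^sup>+ y. tail n y (t - g y) \<partial>K x) \<le> (\<integral>\<^sup>+ y. tail n y (s - g y) \<partial>K x)"
    by (intro nn_integral_mono Suc) (use Suc in auto)
  with Suc.prems tail_le_one[of "Suc n" x t] show ?case by auto
qed auto

lemma tail_le_tail_sup: "tail n x t \<le> tail_sup x t"
  unfolding tail_sup_def by (rule SUP_upper) simp

lemma tail_sup_le_one: "tail_sup x t \<le> 1"
  unfolding tail_sup_def by (intro SUP_least tail_le_one)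

lemma tail_sup_antimono: "s \<le> t \<Longrightarrow> tail_sup x t \<le> tail_sup x s"
  unfolding tail_sup_def by (intro SUP_mono' tail_antimono)

text \<open>At a nonnegative level the empty sum does not count, so one may condition on the first
  step; monotone convergence carries the recursion of \<open>tail\<close> to the limit.\<close>

lemma tail_sup_step:
  assumes "t \<ge> 0"
  shows "tail_sup x t = (\<integral>\<^sup>+ y. tail_sup y (t - g y) \<partial>K x)"
proof -
  have "(\<integral>\<^sup>+ y. tail_sup y (t - g y) \<partial>K x) = (SUP n. \<integral>\<^sup>+ y. tail n y (t - g y) \<partial>K x)"
    unfolding tail_sup_def
    by (rule nn_integral_monotone_convergence_SUP)
       (auto intro!: incseq_SucI le_funI tail_le_Suc simp del: tail.simps)
  also have "\<dots> = (SUP n. tail (Suc n) x t)" using assms by simp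
  also have "\<dots> = tail_sup x t"
  proof (rule antisym)
    show "(SUP n. tail (Suc n) x t) \<le> tail_sup x t"
      by (intro SUP_least tail_le_tail_sup)
    show "tail_sup x t \<le> (SUP n. tail (Suc n) x t)"
      unfolding tail_sup_def by (rule SUP_mono'[OF tail_le_Suc])
  qed
  finally show ?thesis by simp
qed

section \<open>Probability of unbounded partial sums\<close>

lemma unbounded_prob_le_tail_sup: "unbounded_prob x \<le> tail_sup x t"
proof -
  obtain m :: nat where "t \<le> real m" using real_arch_simple by blast
  then have "tail_sup x (real m) \<le> tail_sup x t" by (rule tail_sup_antimono)
  then show ?thesis unfolding unbounded_prob_def by (rule INF_lower2[OF UNIV_I])
qed

text \<open>A fixed shift of all levels is overtaken by passing to a larger integer. This discards
  the first reward \<open>g y\<close> in the one-step recursion, separately for each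
  \<open>y\<close>.\<close>

lemma unbounded_prob_shift: "(INF m. tail_sup x (real m - c)) = unbounded_prob x"
proof (rule antisym)
  show "(INF m. tail_sup x (real m - c)) \<le> unbounded_prob x"
    unfolding unbounded_prob_def
  proof (rule INF_greatest)
    fix m
    obtain k :: nat where "real m + c \<le> real k" using real_arch_simple by blast
    then have "tail_sup x (real k - c) \<le> tail_sup x (real m)"
      by (intro tail_sup_antimono) simp
    then show "(INF m. tail_sup x (real m - c)) \<le> tail_sup x (real m)"
      by (rule INF_lower2[OF UNIV_I])
  qed
qed (intro INF_greatest unbounded_prob_le_tail_sup)

text \<open>Let the level tend to infinity in \<open>tail_sup_step\<close>: the bound by 1 justifies
  exchanging decreasing limit and integral, and the shift by \<open>g y\<close> disappears.\<close>

lemma unbounded_prob_harmonic: "unbounded_prob x = (\<integral>\<^sup>+ y. unbounded_prob y \<partial>K x)"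
proof -
  have fin: "(\<integral>\<^sup>+ y. tail_sup y (real 0 - g y) \<partial>K x) < \<infinity>"
    by (rule le_less_trans[OF nn_integral_mono[OF tail_sup_le_one]]) simp
  have "(\<integral>\<^sup>+ y. unbounded_prob y \<partial>K x) = (\<integral>\<^sup>+ y. (INF m. tail_sup y (real m - g y)) \<partial>K x)"
    by (simp add: unbounded_prob_shift)
  also have "\<dots> = (INF m. \<integral>\<^sup>+ y. tail_sup y (real m - g y) \<partial>K x)"
    by (rule nn_integral_monotone_convergence_INF_decseq[where i = 0])
       (use fin in \<open>auto intro!: decseq_SucI le_funI tail_sup_antimono\<close>)
  also have "\<dots> = unbounded_prob x"
    unfolding unbounded_prob_def by (simp add: tail_sup_step)
  finally show ?thesis by simp
qed

text \<open>When the sums first exceed \<open>t\<close>, they still have probability at least \<open>c\<close> of being unbounded. Hence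
  \<open>c \<le> c P\<^sub>x(max\<^bsub>k\<le>n\<^esub> S\<^sub>k > t) + P\<^sub>x(max\<^bsub>k\<le>n\<^esub> S\<^sub>k \<le> t < sup S\<^sub>k)\<close>, stated below without subtraction,
  and \<open>n \<rightarrow> \<infinity>\<close> gives the claim.\<close>

lemma tail_sup_eq_one:
  assumes pos: "c > 0" and bound: "\<And>x. c \<le> unbounded_prob x"
  shows "tail_sup x t = 1"
proof -
  have c_le: "c \<le> tail_sup x t" for x t
    using bound[of x] unbounded_prob_le_tail_sup[of x t] by (rule order_trans)
  have "c \<le> 1" using c_le tail_sup_le_one by (rule order_trans)
  have step: "c + tail n x t \<le> c * tail n x t + tail_sup x t" for n x t
  proof (induction n arbitrary: x t)
    case 0
    show ?case using c_le[of x t] tail_negative[of t _ x] by (auto simp: tail_sup_def)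
  next
    case (Suc n)
    show ?case
    proof (cases "t < 0")
      case True
      then show ?thesis by (simp add: tail_sup_def tail_negative del: tail.simps)
    next
      case False
      have "c + tail (Suc n) x t = (\<integral>\<^sup>+ y. c + tail n y (t - g y) \<partial>K x)"
        using False by (simp add: nn_integral_add)
      also have "\<dots> \<le> (\<integral>\<^sup>+ y. c * tail n y (t - g y) + tail_sup y (t - g y) \<partial>K x)"
        by (intro nn_integral_mono Suc)
      also have "\<dots> = c * tail (Suc n) x t + tail_sup x t"
        using False by (simp add: nn_integral_add nn_integral_cmult tail_sup_step)
      finally show ?thesis .
    qed
  qed
  have "c + tail_sup x t = (SUP n. c + tail n x t)"
    unfolding tail_sup_def by (simp add: ennreal_SUP_add_right)
  also have "\<dots> \<le> c * tail_sup x t + tail_sup x t"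
    by (intro SUP_least order_trans[OF step] add_mono mult_left_mono tail_le_tail_sup) auto
  finally have *: "c + tail_sup x t \<le> c * tail_sup x t + tail_sup x t" .
  \<comment> \<open>Cancellation in \<open>ennreal\<close> requires finiteness, first of
    \<open>tail_sup x t\<close> and then of \<open>c\<close>.\<close>
  have "tail_sup x t < \<top>" "c < \<top>"
    using tail_sup_le_one[of x t] \<open>c \<le> 1\<close> by (auto intro: le_less_trans)
  with * have "c * 1 \<le> c * tail_sup x t"
    using ennreal_add_left_cancel_le[of "tail_sup x t" c "c * tail_sup x t"]
    by (auto simp: add.commute less_top)
  then have "1 \<le> tail_sup x t"
    using \<open>c > 0\<close> \<open>c < \<top>\<close> by (subst (asm) ennreal_mult_le_mult_iff) auto
  then show ?thesis using tail_sup_le_one by (rule antisym[rotated])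
qed

subsection \<open>Harmonic functions and Harris recurrence\<close>

lemma hit_le_measurable [measurable]:
  assumes [measurable]: "A \<in> sets borel"
  shows "hit_le K A n \<in> borel_measurable borel"
  by (induction n) auto

text \<open>Along the chain \<open>u\<close> is a nonnegative martingale, worth at least
  \<open>c\<close> at the first visit to \<open>A\<close>. Induction over the horizon replaces the
  stopping time.\<close>

lemma harmonic_ge_hit_le:
  assumes A [measurable]: "A \<in> sets borel" and u [measurable]: "u \<in> borel_measurable borel"
    and harmonic: "\<And>x. u x = (\<integral>\<^sup>+ y. u y \<partial>K x)" and ge: "\<And>x. x \<in> A \<Longrightarrow> c \<le> u x"
  shows "c * hit_le K A n x \<le> u x"
proof (induction n arbitrary: x)
  case (Suc n)
  have "c * hit_le K A (Suc n) x = (\<integral>\<^sup>+ y. c * (if y \<in> A then 1 else hit_le K A n y) \<partial>K x)"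
    by (simp add: nn_integral_cmult)
  also have "\<dots> \<le> (\<integral>\<^sup>+ y. u y \<partial>K x)"
    by (intro nn_integral_mono) (use Suc ge in auto)
  finally show ?case by (simp flip: harmonic del: hit_le.simps)
qed simp

text \<open>The same stopping argument for \<open>1 - u\<close>, which equals 1 on \<open>A\<close>;
  the additive form avoids truncated subtraction.\<close>

lemma harmonic_add_hit_le:
  assumes A [measurable]: "A \<in> sets borel" and u [measurable]: "u \<in> borel_measurable borel"
    and harmonic: "\<And>x. u x = (\<integral>\<^sup>+ y. u y \<partial>K x)"
    and le: "\<And>x. u x \<le> 1" and zero: "\<And>x. x \<in> A \<Longrightarrow> u x = 0"
  shows "u x + hit_le K A n x \<le> 1"
proof (induction n arbitrary: x)
  case (Suc n)
  have "u x + hit_le K A (Suc n) x = (\<integral>\<^sup>+ y. u y + (if y \<in> A then 1 else hit_le K A n y) \<partial>K x)"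
    by (subst harmonic) (simp add: nn_integral_add)
  also have "\<dots> \<le> (\<integral>\<^sup>+ y. 1 \<partial>K x)"
    by (intro nn_integral_mono) (use Suc zero in auto)
  finally show ?case by simp
qed (simp add: le)

lemma kpow_measurable [measurable]: "kpow K n \<in> borel \<rightarrow>\<^sub>M subprob_algebra borel"
  by (induction n) (auto intro!: measurable_bind2[OF _ kernel_subprob] simp: return_measurable)

text \<open>These countably many sets cover the space and \<open>K y\<close> has mass one, so from
  each \<open>y\<close> one of them is reached in one step with positive probability. If none were
  \<open>psi_pos\<close>, this would fail for \<phi>-almost every \<open>y\<close>, although \<phi>
  is nonzero.\<close>

lemma psi_pos_dichotomy:
  assumes irr: "irred_measure K \<phi>" and u [measurable]: "u \<in> borel_measurable borel"
  shows "psi_pos K \<phi> {x. u x = (0::ennreal)} \<or> (\<exists>m::nat. psi_pos K \<phi> {x. 1 / of_nat (Suc m) < u x})"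
proof (rule disjCI, rule ccontr)
  let ?B = "\<lambda>m::nat. {x. 1 / of_nat (Suc m) < u x}"
  assume not: "\<not> (\<exists>m. psi_pos K \<phi> (?B m))" and no: "\<not> psi_pos K \<phi> {x. u x = 0}"
  have sets_phi [measurable_cong]: "sets \<phi> = sets borel" and nz: "emeasure \<phi> UNIV \<noteq> 0"
    using irr by (auto simp: irred_measure_def)
  have space_phi: "space \<phi> = UNIV" using sets_eq_imp_space_eq[OF sets_phi] by simp
  have ms: "{y. \<exists>n. emeasure (kpow K n y) A > 0} \<in> sets \<phi>" if [measurable]: "A \<in> sets borel" for A
  proof -
    have "{y\<in>space borel. \<exists>n. emeasure (kpow K n y) A > 0} \<in> sets borel" by measurable
    then show ?thesis by (simp add: sets_phi)
  qed
  \<comment> \<open>The case \<open>n = 1\<close> turns failure of \<open>psi_pos\<close> into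
    nullity under the kernel itself.\<close>
  have "AE y in \<phi>. emeasure (K y) A = 0" if A: "A \<in> sets borel" "\<not> psi_pos K \<phi> A" for A
  proof -
    have "AE y in \<phi>. y \<notin> {y. \<exists>n. emeasure (kpow K n y) A > 0}"
      using A(2) by (intro AE_not_in null_setsI ms A(1)) (simp add: psi_pos_def)
    then show ?thesis
    proof eventually_elim
      case (elim y)
      then have "emeasure (kpow K 1 y) A = 0" by (auto simp del: kpow.simps)
      moreover have "kpow K 1 y = K y"
        using bind_return[OF kernel_subprob, of y] by simp
      ultimately show ?case by (simp only:)
    qed
  qed note null = this
  have "AE y in \<phi>. (\<forall>m. emeasure (K y) (?B m) = 0) \<and> emeasure (K y) {x. u x = 0} = 0"
    using not no by (simp add: AE_all_countable null)
  then have "AE y in \<phi>. False"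
  proof eventually_elim
    case (elim y)
    have "\<exists>m::nat. 1 / of_nat (Suc m) < u x" if "u x \<noteq> 0" for x
    proof (cases "u x = \<top>")
      case True
      then show ?thesis by (intro exI[of _ 0]) simp
    next
      case False
      then obtain r where r: "u x = ennreal r" "r \<ge> 0" by (cases "u x") auto
      with that have "r > 0" by (cases "r = 0") auto
      obtain m where "inverse (real (Suc m)) < r" using reals_Archimedean[OF \<open>r > 0\<close>] by blast
      then have "ennreal (1 / real (Suc m)) < ennreal r" by (simp add: inverse_eq_divide ennreal_lessI \<open>r > 0\<close>)
      moreover have "ennreal (1 / real (Suc m)) = 1 / of_nat (Suc m)"
        by (simp add: divide_ennreal[symmetric] ennreal_of_nat_eq_real_of_nat del: of_nat_Suc)
      ultimately show ?thesis using r by (metis)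
    qed
    then have "(\<Union>m. ?B m) \<union> {x. u x = 0} = UNIV" by auto
    moreover have "emeasure (K y) ((\<Union>m. ?B m) \<union> {x. u x = 0}) = 0"
    proof -
      have "(\<Union>m. ?B m) \<in> null_sets (K y)" by (intro null_sets_UN null_setsI) (use elim in auto)
      moreover have "{x. u x = 0} \<in> null_sets (K y)" by (intro null_setsI) (use elim in auto)
      ultimately show ?thesis by (metis null_sets.Un null_setsD1)
    qed
    ultimately show ?case by simp
  qed
  then show False using nz by (subst (asm) AE_iff_measurable[where N = UNIV]) (auto simp: space_phi sets_phi)
qed

lemma harris_dichotomy:
  assumes harris: "harris_recurrent K"
  shows "(\<forall>x. unbounded_prob x = 0) \<or> (\<forall>x t. tail_sup x t = 1)"
proof -
  obtain \<phi> where irr: "irred_measure K \<phi>"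
    and rec: "\<And>A x. A \<in> sets borel \<Longrightarrow> psi_pos K \<phi> A \<Longrightarrow> io_prob K A x = 1"
    using harris unfolding harris_recurrent_def by blast
  \<comment> \<open>The term \<open>N = 0\<close> of \<open>io_prob\<close> is the probability of
    ever hitting \<open>A\<close>.\<close>
  have hit: "L_hit K A x \<ge> 1" if A [measurable]: "A \<in> sets borel" and "psi_pos K \<phi> A" for A x
  proof -
    have [measurable]: "L_hit K A \<in> borel_measurable borel"
      unfolding L_hit_def[abs_def] by measurable
    have "io_prob K A x \<le> (\<integral>\<^sup>+ y. L_hit K A y \<partial>kpow K 0 x)"
      unfolding io_prob_def by (rule INF_lower) simp
    also have "\<dots> = L_hit K A x" by (simp add: nn_integral_return)
    finally show ?thesis using rec[OF that] by simp
  qed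
  consider "psi_pos K \<phi> {x. unbounded_prob x = 0}"
    | m :: nat where "psi_pos K \<phi> {x. 1 / of_nat (Suc m) < unbounded_prob x}"
    using psi_pos_dichotomy[OF irr unbounded_prob_measurable] by blast
  then show ?thesis
  proof cases
    case 1
    let ?A = "{x. unbounded_prob x = 0}"
    have A: "?A \<in> sets borel" by measurable
    have "unbounded_prob x = 0" for x
    proof -
      have le1: "unbounded_prob x \<le> 1" for x
        using unbounded_prob_le_tail_sup[of x 0] tail_sup_le_one by (rule order_trans)
      \<comment> \<open>Since the zero set is hit with probability one,
        \<open>harmonic_add_hit_le\<close> leaves no mass for
        \<open>unbounded_prob x\<close>.\<close>
      have "unbounded_prob x + 1 \<le> unbounded_prob x + L_hit K ?A x"
        by (intro add_left_mono hit[OF A 1])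
      also have "\<dots> = (SUP n. unbounded_prob x + hit_le K ?A n x)"
        unfolding L_hit_def by (simp add: ennreal_SUP_add_right)
      also have "\<dots> \<le> 1"
        by (intro SUP_least harmonic_add_hit_le[OF A]) (auto simp flip: unbounded_prob_harmonic simp: le1)
      finally have "unbounded_prob x + 1 \<le> 0 + 1" by simp
      then have "1 + unbounded_prob x \<le> 1 + 0" by (simp add: add.commute)
      then show ?thesis unfolding ennreal_add_left_cancel_le by simp
    qed
    then show ?thesis by simp
  next
    case 2
    let ?c = "1 / of_nat (Suc m) :: ennreal" let ?A = "{x. ?c < unbounded_prob x}"
    have A: "?A \<in> sets borel" by measurable
    \<comment> \<open>Every starting point leads to a state with value above \<open>?c\<close>, so
      \<open>harmonic_ge_hit_le\<close> makes the lower bound global.\<close>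
    have "?c \<le> unbounded_prob x" for x
    proof -
      have "?c * 1 \<le> ?c * L_hit K ?A x" by (intro mult_left_mono hit[OF A 2]) simp
      also have "\<dots> = (SUP n. ?c * hit_le K ?A n x)"
        unfolding L_hit_def by (simp add: SUP_mult_left_ennreal)
      also have "\<dots> \<le> unbounded_prob x"
        by (intro SUP_least harmonic_ge_hit_le[OF A]) (auto simp flip: unbounded_prob_harmonic)
      finally show ?thesis by simp
    qed
    moreover have "?c > 0" by (simp add: ennreal_zero_less_divide of_nat_less_top)
    ultimately show ?thesis using tail_sup_eq_one by blast
  qed
qed

subsection \<open>Maximal ergodic inequality\<close>

text \<open>Tail form of (c + M)^+ + min(M, c^-) = c^+ + M for M \<ge> 0. For
  \<open>c \<ge> 0\<close> the second interval on the left is empty, for \<open>c < 0\<close> the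
  first one on the right.\<close>

lemma sum_indicator_tail:
  "indicator {- c..} t * tail n x t + indicator {0..<- c} t * tail n x t
    = indicator {- c..<0} t + indicator {0..} t * tail n x (t::real)"
  by (auto simp: indicator_def tail_negative not_le split: if_splits)

text \<open>Garsia's argument: \<open>max\<^bsub>k\<le>n+1\<^esub> S\<^sub>k = max 0 (g(X\<^sub>1) + M)\<close>, where \<open>M\<close> is the running maximum of the
  chain started at \<open>X\<^sub>1\<close>, which has the law of \<open>max\<^bsub>k\<le>n\<^esub> S\<^sub>k\<close> by stationarity. Comparing the
  expectations, both written as integrals of tails, leaves the claim.\<close>

lemma maximal_inequality:
  assumes mu: "sigma_finite_measure \<mu>" and sets_mu [measurable_cong]: "sets \<mu> = sets borel"
    and stationary: "\<mu> \<bind> K = \<mu>" and fin: "(\<integral>\<^sup>+ x. ennreal (g x) \<partial>\<mu>) < \<infinity>"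
  shows "(\<integral>\<^sup>+ x. \<integral>\<^sup>+ t. indicator {0..<- g x} t * tail n x t \<partial>lborel \<partial>\<mu>)
    \<le> (\<integral>\<^sup>+ x. ennreal (g x) \<partial>\<mu>)"
proof -
  \<comment> \<open>By the layer-cake formula, with M the running maximum up to \<open>n\<close>
    from a start distributed as \<mu>, \<open>A n\<close> is the mean of M and \<open>B n\<close>
    the mean of min(M, g^-), with g^- taken at the start.\<close>
  define A where "A n = (\<integral>\<^sup>+ x. \<integral>\<^sup>+ t. indicator {0..} t * tail n x t \<partial>lborel \<partial>\<mu>)" for n
  define B where "B n = (\<integral>\<^sup>+ x. \<integral>\<^sup>+ t. indicator {0..<- g x} t * tail n x t \<partial>lborel \<partial>\<mu>)" for n
  define G where "G = (\<integral>\<^sup>+ x. ennreal (g x) \<partial>\<mu>)"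
  interpret mu: sigma_finite_measure \<mu> by (rule mu)
  interpret pair: pair_sigma_finite lborel \<mu> ..
  have ind [measurable]: "(\<lambda>z. indicator {a z..} (b z) :: ennreal) \<in> borel_measurable N"
    "(\<lambda>z. indicator {c z..<a z} (b z) :: ennreal) \<in> borel_measurable N"
    if [measurable]: "a \<in> borel_measurable N" "b \<in> borel_measurable N" "c \<in> borel_measurable N"
    for a b c :: "_ \<Rightarrow> real" and N :: "'z measure"
    unfolding indicator_def atLeast_iff atLeastLessThan_iff by measurable
  have step: "A (Suc n) + B n = G + A n" for n
  proof -
    \<comment> \<open>Interchanging the integrals fixes the level \<open>t\<close>, so that
      stationarity absorbs the first transition; translating \<open>t\<close> by \<open>g y\<close>
      then removes the shift.\<close>
    have "A (Suc n) = (\<integral>\<^sup>+ t. \<integral>\<^sup>+ x. indicator {0..} t * tail (Suc n) x t \<partial>\<mu> \<partial>lborel)"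
      unfolding A_def by (rule pair.Fubini') measurable
    also have "\<dots> = (\<integral>\<^sup>+ t. \<integral>\<^sup>+ x. \<integral>\<^sup>+ y. indicator {0..} t * tail n y (t - g y) \<partial>K x \<partial>\<mu> \<partial>lborel)"
      by (intro nn_integral_cong) (auto simp: indicator_def)
    also have "\<dots> = (\<integral>\<^sup>+ t. \<integral>\<^sup>+ y. indicator {0..} t * tail n y (t - g y) \<partial>(\<mu> \<bind> K) \<partial>lborel)"
      by (intro nn_integral_cong nn_integral_bind[symmetric, where B = borel]) auto
    also have "\<dots> = (\<integral>\<^sup>+ y. \<integral>\<^sup>+ t. indicator {0..} t * tail n y (t - g y) \<partial>lborel \<partial>\<mu>)"
      unfolding stationary by (rule pair.Fubini'[symmetric]) measurable
    also have "\<dots> = (\<integral>\<^sup>+ y. \<integral>\<^sup>+ t. indicator {- g y..} t * tail n y t \<partial>lborel \<partial>\<mu>)"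
    proof (rule nn_integral_cong)
      fix y
      have "(\<integral>\<^sup>+ t. indicator {0..} t * tail n y (t - g y) \<partial>lborel)
          = ennreal \<bar>1\<bar> * (\<integral>\<^sup>+ t. indicator {0..} (g y + 1 * t) * tail n y (g y + 1 * t - g y) \<partial>lborel)"
        by (rule nn_integral_real_affine) auto
      also have "\<dots> = (\<integral>\<^sup>+ t. indicator {- g y..} t * tail n y t \<partial>lborel)"
        by (auto intro!: nn_integral_cong simp: indicator_def)
      finally show "(\<integral>\<^sup>+ t. indicator {0..} t * tail n y (t - g y) \<partial>lborel)
          = (\<integral>\<^sup>+ t. indicator {- g y..} t * tail n y t \<partial>lborel)" .
    qed
    finally have "A (Suc n) + B n
        = (\<integral>\<^sup>+ x. (\<integral>\<^sup>+ t. indicator {- g x..} t * tail n x t \<partial>lborel)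
              + (\<integral>\<^sup>+ t. indicator {0..<- g x} t * tail n x t \<partial>lborel) \<partial>\<mu>)"
      unfolding B_def by (simp add: nn_integral_add)
    also have "\<dots> = (\<integral>\<^sup>+ x. ennreal (g x) + (\<integral>\<^sup>+ t. indicator {0..} t * tail n x t \<partial>lborel) \<partial>\<mu>)"
    proof (rule nn_integral_cong)
      fix x
      have "(\<integral>\<^sup>+ t. indicator {- g x..} t * tail n x t \<partial>lborel)
          + (\<integral>\<^sup>+ t. indicator {0..<- g x} t * tail n x t \<partial>lborel)
          = (\<integral>\<^sup>+ t. indicator {- g x..<0} t + indicator {0..} t * tail n x t \<partial>lborel)"
        by (subst nn_integral_add[symmetric]) (auto simp: sum_indicator_tail simp del: tail.simps)
      also have "\<dots> = emeasure lborel {- g x..<0} + (\<integral>\<^sup>+ t. indicator {0..} t * tail n x t \<partial>lborel)"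
        by (simp add: nn_integral_add)
      also have "emeasure lborel {- g x..<0} = ennreal (g x)"
        by (cases "0 \<le> g x") (auto simp: ennreal_neg)
      finally show "(\<integral>\<^sup>+ t. indicator {- g x..} t * tail n x t \<partial>lborel)
          + (\<integral>\<^sup>+ t. indicator {0..<- g x} t * tail n x t \<partial>lborel)
          = ennreal (g x) + (\<integral>\<^sup>+ t. indicator {0..} t * tail n x t \<partial>lborel)" .
    qed
    also have "\<dots> = G + A n"
      unfolding A_def G_def by (simp add: nn_integral_add)
    finally show ?thesis .
  qed
  have A0: "A 0 = 0"
    unfolding A_def by (simp add: indicator_def nn_integral_0_iff_AE cong: if_cong)
  \<comment> \<open>Cancelling \<open>A n\<close> from the balance requires it to be finite, which
    propagates from \<open>A 0 = 0\<close> because \<open>G\<close> is finite.\<close>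
  have A_finite: "A n < \<infinity>" for n
  proof (induction n)
    case (Suc n)
    have "A (Suc n) \<le> G + A n" unfolding step[symmetric] by simp
    also have "\<dots> < \<infinity>" using Suc fin by (simp add: G_def)
    finally show ?case .
  qed (simp add: A0)
  have "A n + B n \<le> A (Suc n) + B n"
    unfolding A_def by (intro add_right_mono nn_integral_mono mult_left_mono tail_le_Suc) simp
  also have "\<dots> = A n + G" by (subst step) (rule add.commute)
  finally have "B n \<le> G"
    using A_finite[of n] by (auto simp: ennreal_add_left_cancel_le)
  then show ?thesis by (simp add: B_def G_def)
qed

text \<open>If every level is exceeded with probability one, the truncated means min(M, g^-)
  increase to the integral of g^-, and the maximal inequality becomes the comparison of g^- with
  g^+.\<close>

lemma mean_nonneg:
  assumes mu: "sigma_finite_measure \<mu>" and sets_mu [measurable_cong]: "sets \<mu> = sets borel"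
    and stationary: "\<mu> \<bind> K = \<mu>" and int: "integrable \<mu> g"
    and one: "\<And>x t. tail_sup x t = 1"
  shows "0 \<le> (\<integral>x. g x \<partial>\<mu>)"
proof -
  have pos_fin: "(\<integral>\<^sup>+ x. ennreal (g x) \<partial>\<mu>) < \<infinity>" and neg_fin: "(\<integral>\<^sup>+ x. ennreal (- g x) \<partial>\<mu>) < \<infinity>"
    using int by (auto simp: real_integrable_def less_top)
  have ind [measurable]: "(\<lambda>z. indicator {0..<- g (fst z)} (snd z) :: ennreal) \<in> borel_measurable (\<mu> \<Otimes>\<^sub>M lborel)"
    unfolding indicator_def atLeastLessThan_iff by measurable
  have meas [measurable]: "(\<lambda>x. \<integral>\<^sup>+ t. indicator {0..<- g x} t * tail n x t \<partial>lborel) \<in> borel_measurable \<mu>" for n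
    by (rule lborel.borel_measurable_nn_integral) measurable
  have mono: "indicator {0..<- g x} t * tail n x t \<le> indicator {0..<- g x} t * tail (Suc n) x t" for n x t
    by (intro mult_left_mono tail_le_Suc) simp
  have "(\<integral>\<^sup>+ x. ennreal (- g x) \<partial>\<mu>)
      = (\<integral>\<^sup>+ x. \<integral>\<^sup>+ t. (SUP n. indicator {0..<- g x} t * tail n x t) \<partial>lborel \<partial>\<mu>)"
  proof (rule nn_integral_cong)
    fix x
    have "(\<integral>\<^sup>+ t. (SUP n. indicator {0..<- g x} t * tail n x t) \<partial>lborel) = emeasure lborel {0..<- g x}"
      using one by (simp add: SUP_mult_left_ennreal[symmetric] tail_sup_def[symmetric])
    also have "\<dots> = ennreal (- g x)"
      by (cases "0 \<le> - g x") (auto simp: ennreal_neg)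
    finally show "ennreal (- g x) = (\<integral>\<^sup>+ t. (SUP n. indicator {0..<- g x} t * tail n x t) \<partial>lborel)" ..
  qed
  also have "\<dots> = (\<integral>\<^sup>+ x. (SUP n. \<integral>\<^sup>+ t. indicator {0..<- g x} t * tail n x t \<partial>lborel) \<partial>\<mu>)"
    by (intro nn_integral_cong nn_integral_monotone_convergence_SUP incseq_SucI le_funI mono) measurable
  also have "\<dots> = (SUP n. \<integral>\<^sup>+ x. \<integral>\<^sup>+ t. indicator {0..<- g x} t * tail n x t \<partial>lborel \<partial>\<mu>)"
    by (intro nn_integral_monotone_convergence_SUP incseq_SucI le_funI nn_integral_mono mono meas)
  also have "\<dots> \<le> (\<integral>\<^sup>+ x. ennreal (g x) \<partial>\<mu>)"
    by (intro SUP_least maximal_inequality mu sets_mu stationary pos_fin)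
  finally have "enn2real (\<integral>\<^sup>+ x. ennreal (- g x) \<partial>\<mu>) \<le> enn2real (\<integral>\<^sup>+ x. ennreal (g x) \<partial>\<mu>)"
    using pos_fin by (intro enn2real_mono) auto
  then show ?thesis by (simp add: real_lebesgue_integral_def[OF int])
qed

end

section \<open>Chains with a given kernel\<close>

lemma sets_nat_filtr:
  "sets (nat_filtr M X n) = sigma_sets (space M) {X t -` A \<inter> space M | t A. t \<in> {1..n} \<and> A \<in> sets borel}"
  unfolding nat_filtr_def by (rule sets_measure_of) auto

lemma space_nat_filtr [simp]: "space (nat_filtr M X n) = space M"
  unfolding nat_filtr_def by (rule space_measure_of) auto

lemma subalgebra_nat_filtr:
  assumes [measurable]: "\<And>t. X t \<in> M \<rightarrow>\<^sub>M borel"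
  shows "subalgebra M (nat_filtr M X n)"
  unfolding subalgebra_def sets_nat_filtr by (auto intro!: sets.sigma_sets_subset)

lemma sets_nat_filtr_mono: "m \<le> n \<Longrightarrow> sets (nat_filtr M X m) \<subseteq> sets (nat_filtr M X n)"
  unfolding sets_nat_filtr by (intro sigma_sets_mono') fastforce

lemma measurable_nat_filtr_mono:
  "f \<in> nat_filtr M X m \<rightarrow>\<^sub>M N \<Longrightarrow> m \<le> n \<Longrightarrow> f \<in> nat_filtr M X n \<rightarrow>\<^sub>M N"
  using sets_nat_filtr_mono[of m n M X] by (auto simp: measurable_def)

lemma measurable_nat_filtr: "t \<in> {1..n} \<Longrightarrow> X t \<in> nat_filtr M X n \<rightarrow>\<^sub>M borel"
  by (rule measurableI) (auto simp: sets_nat_filtr intro!: sigma_sets.Basic)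

section \<open>The Markov property and bounds along trajectories\<close>

context markov_reward
begin

text \<open>\<open>markov_chain\<close> prescribes conditional probabilities of single events. These
  determine the joint law of past and next state on rectangles, an intersection-stable generator,
  hence for integrands depending on the whole past.\<close>

lemma nn_integral_markov:
  assumes chain: "markov_chain M K X" and n: "n \<ge> 1"
    and f [measurable]: "f \<in> borel_measurable (nat_filtr M X n \<Otimes>\<^sub>M borel)"
  shows "(\<integral>\<^sup>+ \<omega>. f (\<omega>, X (Suc n) \<omega>) \<partial>M) = (\<integral>\<^sup>+ \<omega>. \<integral>\<^sup>+ y. f (\<omega>, y) \<partial>K (X n \<omega>) \<partial>M)"
proof -
  let ?F = "nat_filtr M X n" and ?P = "nat_filtr M X n \<Otimes>\<^sub>M (borel :: 'a measure)"
  interpret prob_space M using chain by (simp add: markov_chain_def)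
  have X [measurable]: "X t \<in> M \<rightarrow>\<^sub>M borel" for t using chain by (simp add: markov_chain_def)
  have sub: "subalgebra M ?F" by (rule subalgebra_nat_filtr[OF X])
  interpret finite_measure_subalgebra M ?F by unfold_locales (rule sub)
  have id_F: "(\<lambda>\<omega>. \<omega>) \<in> M \<rightarrow>\<^sub>M ?F" by (rule measurable_from_subalg[OF sub]) simp
  have pair [measurable]: "(\<lambda>\<omega>. (\<omega>, X (Suc n) \<omega>)) \<in> M \<rightarrow>\<^sub>M ?P"
    by (rule measurable_Pair[OF id_F X])
  have Pair_K: "Pair \<omega> \<in> K x \<rightarrow>\<^sub>M ?P" if "\<omega> \<in> space M" for \<omega> x
    using measurable_Pair1'[of \<omega> ?F borel] that by (simp add: measurable_cong_sets[OF sets_kernel_borel refl])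
  \<comment> \<open>Keep the past and redraw the next state from the kernel.\<close>
  let ?J = "\<lambda>\<omega>. distr (K (X n \<omega>)) ?P (Pair \<omega>)"
  have J: "?J \<in> M \<rightarrow>\<^sub>M subprob_algebra ?P"
  proof (rule measurable_distr2[where M = borel])
    show "case_prod Pair \<in> M \<Otimes>\<^sub>M borel \<rightarrow>\<^sub>M ?P"
      using measurable_Pair[OF measurable_compose[OF measurable_fst id_F] measurable_snd] by (simp add: split_beta')
    show "(\<lambda>\<omega>. K (X n \<omega>)) \<in> M \<rightarrow>\<^sub>M subprob_algebra borel"
      by (rule measurable_compose[OF X kernel_subprob])
  qed
  have "distr M ?P (\<lambda>\<omega>. (\<omega>, X (Suc n) \<omega>)) = M \<bind> ?J"
  proof (rule measure_eqI_generator_eq[OF Int_stable_pair_measure_generator[of ?F borel], where \<Omega> = "space ?F \<times> UNIV"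
        and A = "\<lambda>_. space ?F \<times> UNIV"])
    fix Z assume "Z \<in> {a \<times> b |a b. a \<in> sets ?F \<and> b \<in> sets (borel :: 'a measure)}"
    then obtain A B where Z: "Z = A \<times> B" and A: "A \<in> sets ?F" and B [measurable]: "B \<in> sets borel" by auto
    have Z_P: "Z \<in> sets ?P" unfolding Z by (rule pair_measureI[OF A B])
    have [measurable]: "A \<in> sets M" using A sub by (auto simp: subalgebra_def)
    have KB: "(\<lambda>\<omega>. measure (K (X n \<omega>)) B) \<in> borel_measurable M"
      by (rule measurable_compose[OF measurable_compose[OF X kernel_subprob] measurable_measure_subprob_algebra[OF B]])
    have "emeasure (distr M ?P (\<lambda>\<omega>. (\<omega>, X (Suc n) \<omega>))) Z
        = emeasure M (A \<inter> (X (Suc n) -` B \<inter> space M))"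
      unfolding Z using A sets.sets_into_space[OF \<open>A \<in> sets M\<close>]
      by (subst emeasure_distr) (auto intro!: arg_cong[of _ _ "emeasure M"])
    also have "\<dots> = ennreal (\<integral>\<omega>\<in>A. indicator B (X (Suc n) \<omega>) \<partial>M)"
    proof -
      have "(\<integral>\<omega>\<in>A. indicator B (X (Suc n) \<omega>) \<partial>M)
          = (\<integral>\<omega>. indicat_real (A \<inter> (X (Suc n) -` B \<inter> space M)) \<omega> \<partial>M)"
        unfolding set_lebesgue_integral_def
        by (intro Bochner_Integration.integral_cong) (auto simp: indicator_def)
      then show ?thesis by (simp add: emeasure_eq_measure Int_absorb2 sets.sets_into_space)
    qed
    also have "(\<integral>\<omega>\<in>A. indicator B (X (Suc n) \<omega>) \<partial>M)
        = (\<integral>\<omega>\<in>A. real_cond_exp M ?F (\<lambda>\<omega>. indicator B (X (Suc n) \<omega>)) \<omega> \<partial>M)"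
      by (rule real_cond_exp_intA[OF _ A])
         (auto intro!: integrable_const_bound[where B = 1] simp: indicator_def)
    also have "\<dots> = (\<integral>\<omega>\<in>A. measure (K (X n \<omega>)) B \<partial>M)"
    proof (rule set_lebesgue_integral_cong_AE)
      show "AE \<omega>\<in>A in M. real_cond_exp M ?F (\<lambda>\<omega>. indicator B (X (Suc n) \<omega>)) \<omega> = measure (K (X n \<omega>)) B"
      proof -
        have "AE \<omega> in M. real_cond_exp M ?F (\<lambda>\<omega>. indicator B (X (Suc n) \<omega>)) \<omega> = measure (K (X n \<omega>)) B"
          using n B
          by (rule chain[unfolded markov_chain_def, THEN conjunct2, THEN conjunct2, THEN conjunct2, rule_format])
        then show ?thesis by eventually_elim simp
      qed
      have "real_cond_exp M ?F (\<lambda>\<omega>. indicator B (X (Suc n) \<omega>)) \<in> borel_measurable M"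
        by (rule measurable_from_subalg[OF sub borel_measurable_cond_exp])
      then show "(\<lambda>\<omega>. real_cond_exp M ?F (\<lambda>\<omega>. indicator B (X (Suc n) \<omega>)) \<omega>) \<in> borel_measurable M" .
      show "(\<lambda>\<omega>. measure (K (X n \<omega>)) B) \<in> borel_measurable M" by (rule KB)
    qed (rule \<open>A \<in> sets M\<close>)
    also have "ennreal \<dots> = (\<integral>\<^sup>+ \<omega>. ennreal (indicator A \<omega> * measure (K (X n \<omega>)) B) \<partial>M)"
      unfolding set_lebesgue_integral_def real_scaleR_def
    proof (rule nn_integral_eq_integral[symmetric])
      show "integrable M (\<lambda>\<omega>. indicator A \<omega> * measure (K (X n \<omega>)) B)"
      proof (rule integrable_const_bound[where B = 1])
        have "measure (K x) B \<le> 1" for x by (rule prob_space.prob_le_1[OF prob_space_kernel])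
        then show "AE \<omega> in M. norm (indicator A \<omega> * measure (K (X n \<omega>)) B) \<le> 1"
          by (intro AE_I2) (simp add: indicator_def)
      qed (intro borel_measurable_times borel_measurable_indicator KB \<open>A \<in> sets M\<close>)
    qed simp
    also have "\<dots> = (\<integral>\<^sup>+ \<omega>. emeasure (?J \<omega>) Z \<partial>M)"
    proof (rule nn_integral_cong)
      fix \<omega> assume "\<omega> \<in> space M"
      then have "emeasure (?J \<omega>) Z = emeasure (K (X n \<omega>)) (Pair \<omega> -` Z \<inter> space (K (X n \<omega>)))"
        by (intro emeasure_distr Pair_K Z_P)
      also have "Pair \<omega> -` Z \<inter> space (K (X n \<omega>)) = (if \<omega> \<in> A then B else {})" by (auto simp: Z)
      finally show "ennreal (indicator A \<omega> * measure (K (X n \<omega>)) B) = emeasure (?J \<omega>) Z"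
        using finite_measure.emeasure_eq_measure[OF prob_space.finite_measure[OF prob_space_kernel], of "X n \<omega>" B]
        by simp
    qed
    also have "\<dots> = emeasure (M \<bind> ?J) Z"
      by (rule emeasure_bind[symmetric, OF not_empty J Z_P])
    finally show "emeasure (distr M ?P (\<lambda>\<omega>. (\<omega>, X (Suc n) \<omega>))) Z = emeasure (M \<bind> ?J) Z" .
  next
    show "sets (M \<bind> ?J) = sigma_sets (space ?F \<times> UNIV) {a \<times> b |a b. a \<in> sets ?F \<and> b \<in> sets borel}"
      using sets_bind[OF sets_kernel[OF J] not_empty] by (simp add: sets_pair_measure)
    show "range (\<lambda>_. space ?F \<times> UNIV) \<subseteq> {a \<times> b |a b. a \<in> sets ?F \<and> b \<in> sets (borel :: 'a measure)}"
      unfolding image_subset_iff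
      by (intro ballI CollectI exI[of _ "space ?F"] exI[of _ UNIV]) (use sets.top[of ?F] in simp)
    show "emeasure (distr M ?P (\<lambda>\<omega>. (\<omega>, X (Suc n) \<omega>))) (space ?F \<times> UNIV) \<noteq> \<infinity>"
      using finite_measure.emeasure_finite[OF finite_measure_distr[OF pair]] by simp
  qed (auto simp: sets_pair_measure dest: subsetD[OF sets.sets_into_space])
  then have "(\<integral>\<^sup>+ z. f z \<partial>distr M ?P (\<lambda>\<omega>. (\<omega>, X (Suc n) \<omega>))) = (\<integral>\<^sup>+ z. f z \<partial>(M \<bind> ?J))" by simp
  also have "\<dots> = (\<integral>\<^sup>+ \<omega>. \<integral>\<^sup>+ z. f z \<partial>?J \<omega> \<partial>M)"
    by (rule nn_integral_bind[OF f J])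
  also have "\<dots> = (\<integral>\<^sup>+ \<omega>. \<integral>\<^sup>+ y. f (\<omega>, y) \<partial>K (X n \<omega>) \<partial>M)"
    by (intro nn_integral_cong, subst nn_integral_distr) (simp_all add: Pair_K f)
  finally show ?thesis by (simp add: nn_integral_distr pair f)
qed

text \<open>Induction over the horizon, conditioning on one transition. Event and threshold may be
  anything known at time \<open>n\<close>, because the next threshold
  \<open>Z - g (X (Suc n))\<close> is random and known at time \<open>Suc n\<close>.\<close>

lemma emeasure_exceed_le:
  assumes chain: "markov_chain M K X" and "n \<ge> 1"
    and "A \<in> sets (nat_filtr M X n)" and "Z \<in> borel_measurable (nat_filtr M X n)"
  shows "emeasure M {\<omega> \<in> A. \<exists>k\<le>N. (\<Sum>i\<in>{n<..n+k}. g (X i \<omega>)) > Z \<omega>}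
    \<le> (\<integral>\<^sup>+ \<omega>. indicator A \<omega> * tail N (X n \<omega>) (Z \<omega>) \<partial>M)"
  using assms(2-)
proof (induction N arbitrary: n A Z)
  have X [measurable]: "X t \<in> M \<rightarrow>\<^sub>M borel" for t using chain by (simp add: markov_chain_def)
  have sub: "subalgebra M (nat_filtr M X n)" for n by (rule subalgebra_nat_filtr[OF X])
  {
    case 0
    have [measurable]: "A \<in> sets M" "Z \<in> borel_measurable M"
      using 0 sub measurable_from_subalg[OF sub] by (auto simp: subalgebra_def)
    have eq: "{\<omega> \<in> A. \<exists>k\<le>0. (\<Sum>i\<in>{n<..n+k}. g (X i \<omega>)) > Z \<omega>} = {\<omega> \<in> space M. \<omega> \<in> A \<and> Z \<omega> < 0}"
      using sets.sets_into_space[OF \<open>A \<in> sets M\<close>] by auto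
    have "emeasure M {\<omega> \<in> space M. \<omega> \<in> A \<and> Z \<omega> < 0}
        = (\<integral>\<^sup>+ \<omega>. indicator {\<omega> \<in> space M. \<omega> \<in> A \<and> Z \<omega> < 0} \<omega> \<partial>M)"
      by simp
    also have "\<dots> \<le> (\<integral>\<^sup>+ \<omega>. indicator A \<omega> * tail 0 (X n \<omega>) (Z \<omega>) \<partial>M)"
      by (intro nn_integral_mono) (auto simp: indicator_def)
    finally show ?case unfolding eq .
  next
    case (Suc N)
    let ?F = "nat_filtr M X n" and ?F' = "nat_filtr M X (Suc n)"
    have [measurable]: "A \<in> sets M" "Z \<in> borel_measurable M"
      using Suc.prems sub measurable_from_subalg[OF sub] by (auto simp: subalgebra_def)
    note [measurable] = Suc.prems(2,3)
    have Xn [measurable]: "X n \<in> borel_measurable ?F"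
      using Suc.prems by (intro measurable_nat_filtr) auto
    \<comment> \<open>On \<open>C\<close> the empty sum already exceeds \<open>Z\<close>; on
      \<open>A'\<close> an exceedance needs at least one more reward.\<close>
    define A' where "A' = {\<omega> \<in> space ?F. \<omega> \<in> A \<and> 0 \<le> Z \<omega>}"
    define C where "C = {\<omega> \<in> space M. \<omega> \<in> A \<and> Z \<omega> < 0}"
    define Z' where "Z' \<omega> = Z \<omega> - g (X (Suc n) \<omega>)" for \<omega>
    let ?E = "{\<omega> \<in> A'. \<exists>k\<le>N. (\<Sum>i\<in>{Suc n<..Suc n+k}. g (X i \<omega>)) > Z' \<omega>}"
    have [measurable]: "C \<in> sets M" unfolding C_def by measurable
    have A'_F [measurable]: "A' \<in> sets ?F" unfolding A'_def by measurable
    have A'_F': "A' \<in> sets ?F'" using A'_F sets_nat_filtr_mono[of n "Suc n" M X] by auto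
    have [measurable]: "A' \<in> sets M"
      by (rule subsetD[OF _ A'_F]) (use sub in \<open>simp add: subalgebra_def\<close>)
    have Z' : "Z' \<in> borel_measurable ?F'"
    proof -
      have [measurable]: "Z \<in> borel_measurable ?F'" "X (Suc n) \<in> borel_measurable ?F'"
        by (auto intro: measurable_nat_filtr_mono[OF Suc.prems(3)] measurable_nat_filtr)
      show ?thesis unfolding Z'_def[abs_def] by measurable
    qed
    have "{\<omega> \<in> A. \<exists>k\<le>Suc N. (\<Sum>i\<in>{n<..n+k}. g (X i \<omega>)) > Z \<omega>} \<subseteq> C \<union> ?E"
    proof safe
      fix \<omega> k assume \<omega>: "\<omega> \<in> A" "\<omega> \<notin> C" and k: "k \<le> Suc N" "(\<Sum>i\<in>{n<..n+k}. g (X i \<omega>)) > Z \<omega>"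
      have "\<omega> \<in> space M" using \<omega>(1) sets.sets_into_space[OF \<open>A \<in> sets M\<close>] by auto
      then show "\<omega> \<in> A'" using \<omega> by (auto simp: A'_def C_def not_less)
      then have "0 \<le> Z \<omega>" by (simp add: A'_def)
      with k obtain j where j: "k = Suc j" by (cases k) auto
      have "{n<..n+k} = insert (Suc n) {Suc n<..Suc n+j}" using j by auto
      with k(2) have "(\<Sum>i\<in>{Suc n<..Suc n+j}. g (X i \<omega>)) > Z' \<omega>" by (simp add: Z'_def)
      then show "\<exists>k\<le>N. (\<Sum>i\<in>{Suc n<..Suc n+k}. g (X i \<omega>)) > Z' \<omega>" using j k(1) by auto
    qed
    then have "emeasure M {\<omega> \<in> A. \<exists>k\<le>Suc N. (\<Sum>i\<in>{n<..n+k}. g (X i \<omega>)) > Z \<omega>} \<le> emeasure M (C \<union> ?E)"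
      by (rule emeasure_mono) (simp add: Z'_def, measurable)
    also have "\<dots> \<le> emeasure M C + emeasure M ?E"
      by (rule emeasure_subadditive) (simp_all add: Z'_def, measurable)
    also have "\<dots> \<le> emeasure M C + (\<integral>\<^sup>+ \<omega>. indicator A' \<omega> * tail N (X (Suc n) \<omega>) (Z' \<omega>) \<partial>M)"
      by (intro add_left_mono Suc.IH A'_F' Z') simp
    also have "(\<integral>\<^sup>+ \<omega>. indicator A' \<omega> * tail N (X (Suc n) \<omega>) (Z' \<omega>) \<partial>M)
        = (\<integral>\<^sup>+ \<omega>. \<integral>\<^sup>+ y. indicator A' \<omega> * tail N y (Z \<omega> - g y) \<partial>K (X n \<omega>) \<partial>M)"
      using nn_integral_markov[OF chain Suc.prems(1),
          of "\<lambda>(\<omega>, y). indicator A' \<omega> * tail N y (Z \<omega> - g y)"]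
      by (simp add: Z'_def)
    also have "emeasure M C + \<dots> = (\<integral>\<^sup>+ \<omega>. indicator C \<omega> + (\<integral>\<^sup>+ y. indicator A' \<omega> * tail N y (Z \<omega> - g y) \<partial>K (X n \<omega>)) \<partial>M)"
      by (subst nn_integral_add) auto
    also have "\<dots> \<le> (\<integral>\<^sup>+ \<omega>. indicator A \<omega> * tail (Suc N) (X n \<omega>) (Z \<omega>) \<partial>M)"
      by (intro nn_integral_mono) (auto simp: A'_def C_def indicator_def)
    finally show ?case .
  }
qed

theorem partial_sums_bounded_above:
  assumes chain: "markov_chain M K X" and harris: "harris_recurrent K"
    and mu: "sigma_finite_measure \<mu>" "sets \<mu> = sets borel" "\<mu> \<bind> K = \<mu>"
    and int: "integrable \<mu> g" "(\<integral>x. g x \<partial>\<mu>) < 0"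
  shows "AE \<omega> in M. \<exists>b. \<forall>n. (\<Sum>i=1..n. g (X i \<omega>)) \<le> b"
proof -
  interpret prob_space M using chain by (simp add: markov_chain_def)
  have X [measurable]: "X t \<in> M \<rightarrow>\<^sub>M borel" for t using chain by (simp add: markov_chain_def)
  \<comment> \<open>The other branch of the dichotomy would make the mean reward
    nonnegative.\<close>
  have zero: "unbounded_prob x = 0" for x
    using harris_dichotomy[OF harris] mean_nonneg[OF mu int(1)] int(2) by force
  \<comment> \<open>The sums begin with \<open>X 2\<close>, since \<open>tail\<close> counts rewards
    after the starting state \<open>X 1\<close>. The reward at \<open>X 1\<close> enters the final
    bound through its absolute value, which also covers the empty sum.\<close>
  define E where "E m = {\<omega> \<in> space M. \<exists>k. (\<Sum>i\<in>{1<..1+k}. g (X i \<omega>)) > real m}" for m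
  have [measurable]: "E m \<in> sets M" for m unfolding E_def by measurable
  have E_le: "emeasure M (E m) \<le> (\<integral>\<^sup>+ \<omega>. tail_sup (X 1 \<omega>) (real m) \<partial>M)" for m
  proof -
    let ?E = "\<lambda>N. {\<omega> \<in> space M. \<exists>k\<le>N. (\<Sum>i\<in>{1<..1+k}. g (X i \<omega>)) > real m}"
    have "emeasure M (E m) = emeasure M (\<Union>N. ?E N)"
      by (intro arg_cong[of _ _ "emeasure M"]) (auto simp: E_def)
    also have "\<dots> = (SUP N. emeasure M (?E N))"
      by (rule SUP_emeasure_incseq[symmetric]) (auto simp: incseq_def intro: order_trans)
    also have "\<dots> \<le> (\<integral>\<^sup>+ \<omega>. tail_sup (X 1 \<omega>) (real m) \<partial>M)"
    proof (rule SUP_least)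
      fix N
      have "emeasure M (?E N) \<le> (\<integral>\<^sup>+ \<omega>. indicator (space M) \<omega> * tail N (X 1 \<omega>) (real m) \<partial>M)"
        using emeasure_exceed_le[OF chain, of 1 "space M" "\<lambda>_. real m" N] sets.top[of "nat_filtr M X 1"]
        by simp
      also have "\<dots> \<le> (\<integral>\<^sup>+ \<omega>. tail_sup (X 1 \<omega>) (real m) \<partial>M)"
        by (intro nn_integral_mono) (simp add: tail_le_tail_sup)
      finally show "emeasure M (?E N) \<le> (\<integral>\<^sup>+ \<omega>. tail_sup (X 1 \<omega>) (real m) \<partial>M)" .
    qed
    finally show ?thesis .
  qed
  have "(INF m. \<integral>\<^sup>+ \<omega>. tail_sup (X 1 \<omega>) (real m) \<partial>M) = (\<integral>\<^sup>+ \<omega>. (INF m. tail_sup (X 1 \<omega>) (real m)) \<partial>M)"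
  proof (rule nn_integral_monotone_convergence_INF_decseq[symmetric, where i = 0])
    show "(\<integral>\<^sup>+ \<omega>. tail_sup (X 1 \<omega>) (real 0) \<partial>M) < \<infinity>"
      by (rule le_less_trans[OF nn_integral_mono[OF tail_sup_le_one]]) (simp add: emeasure_space_1)
  qed (auto intro!: decseq_SucI le_funI tail_sup_antimono)
  also have "\<dots> = 0" using zero by (simp add: unbounded_prob_def)
  finally have INF_zero: "(INF m. \<integral>\<^sup>+ \<omega>. tail_sup (X 1 \<omega>) (real m) \<partial>M) = 0" .
  have "emeasure M (\<Inter>m. E m) \<le> (\<integral>\<^sup>+ \<omega>. tail_sup (X 1 \<omega>) (real m) \<partial>M)" for m
    by (rule order_trans[OF emeasure_mono E_le]) auto
  then have "emeasure M (\<Inter>m. E m) \<le> 0"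
    unfolding INF_zero[symmetric] by (rule INF_greatest)
  then have "AE \<omega> in M. \<omega> \<notin> (\<Inter>m. E m)"
    by (intro AE_not_in null_setsI) auto
  then show ?thesis
    using AE_space
  proof eventually_elim
    case (elim \<omega>)
    then obtain m where m: "(\<Sum>i\<in>{1<..1+k}. g (X i \<omega>)) \<le> real m" for k
      by (auto simp: E_def not_less)
    have "(\<Sum>i=1..n. g (X i \<omega>)) \<le> \<bar>g (X 1 \<omega>)\<bar> + real m" for n
    proof (cases n)
      case (Suc k)
      have "{1..n} = insert 1 {1<..1+k}" using Suc by auto
      then show ?thesis using m[of k] by simp
    qed simp
    then show ?case by blast
  qed
qed

end

section \<open>Strong law of large numbers\<close>

lemma averages_eventually_less:
  assumes chain: "markov_chain M K X" and harris: "harris_recurrent K"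
    and mu: "prob_space \<mu>" "sets \<mu> = sets borel" "\<mu> \<bind> K = \<mu>"
    and f: "f \<in> borel_measurable borel" "integrable \<mu> f" and e: "e > 0"
  shows "AE \<omega> in M. \<forall>\<^sub>F n in sequentially. (\<Sum>t=1..n. f (X t \<omega>)) / real n < (\<integral>x. f x \<partial>\<mu>) + e"
proof -
  interpret mu: prob_space \<mu> by (rule mu)
  \<comment> \<open>One half of \<open>e\<close> gives the reward negative mean, the other absorbs
    the bounded sums divided by \<open>n\<close>.\<close>
  let ?c = "(\<integral>x. f x \<partial>\<mu>) + e / 2"
  interpret markov_reward K "\<lambda>x. f x - ?c"
    using chain f by unfold_locales (auto simp: markov_chain_def)
  have "AE \<omega> in M. \<exists>b. \<forall>n. (\<Sum>i=1..n. f (X i \<omega>) - ?c) \<le> b"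
    by (rule partial_sums_bounded_above[OF chain harris mu.sigma_finite_measure_axioms mu(2,3)])
       (use f e in \<open>simp_all add: mu.prob_space\<close>)
  then show ?thesis
  proof eventually_elim
    case (elim \<omega>)
    then obtain b where b: "(\<Sum>i=1..n. f (X i \<omega>) - ?c) \<le> b" for n by blast
    have "(\<lambda>n. b / real n) \<longlonglongrightarrow> 0" by real_asymp
    then have "\<forall>\<^sub>F n in sequentially. b / real n < e / 2"
      using e by (intro order_tendstoD) auto
    then show ?case using eventually_gt_at_top[of 0]
    proof eventually_elim
      case (elim n)
      have "(\<Sum>i=1..n. f (X i \<omega>)) \<le> b + ?c * real n"
        using b[of n] by (simp add: sum_subtractf algebra_simps)
      then have "(\<Sum>i=1..n. f (X i \<omega>)) / real n \<le> b / real n + ?c"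
        using elim by (simp add: field_simps)
      then show ?case using elim(1) by linarith
    qed
  qed
qed

text \<open>The one-sided bound is applied to \<open>f\<close> and \<open>- f\<close>; countably
  many tolerances allow a single exceptional null set.\<close>

theorem harris_strong_law:
  assumes chain: "markov_chain M K X" and harris: "harris_recurrent K"
    and mu: "prob_space \<mu>" "sets \<mu> = sets borel" "\<mu> \<bind> K = \<mu>"
    and f: "f \<in> borel_measurable borel" "integrable \<mu> f"
  shows "AE \<omega> in M. (\<lambda>n. (\<Sum>t=1..n. f (X t \<omega>)) / real n) \<longlonglongrightarrow> (\<integral>x. f x \<partial>\<mu>)"
proof -
  let ?e = "\<lambda>m::nat. inverse (real (Suc m))"
  have "AE \<omega> in M. \<forall>m. \<forall>\<^sub>F n in sequentially. (\<Sum>t=1..n. f (X t \<omega>)) / real n < (\<integral>x. f x \<partial>\<mu>) + ?e m"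
    unfolding AE_all_countable by (intro allI averages_eventually_less[OF chain harris mu f]) simp
  moreover have "AE \<omega> in M. \<forall>m. \<forall>\<^sub>F n in sequentially.
      (\<Sum>t=1..n. - f (X t \<omega>)) / real n < (\<integral>x. - f x \<partial>\<mu>) + ?e m"
    unfolding AE_all_countable by (intro allI averages_eventually_less[OF chain harris mu]) (use f in auto)
  ultimately show ?thesis
  proof eventually_elim
    case (elim \<omega>)
    show ?case
    proof (rule tendstoI)
      fix e :: real assume "e > 0"
      then obtain m where m: "?e m < e" using reals_Archimedean by blast
      show "\<forall>\<^sub>F n in sequentially. dist ((\<Sum>t=1..n. f (X t \<omega>)) / real n) (\<integral>x. f x \<partial>\<mu>) < e"
        using elim(1)[rule_format, of m] elim(2)[rule_format, of m]
      proof eventually_elim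
        case (elim n)
        then show ?case using m by (auto simp: dist_real_def sum_negf abs_less_iff)
      qed
    qed
  qed
qed

section \<open>Moreau-Yosida envelopes and Gibbs measures\<close>

text \<open>Sublevel sets at real heights are slices of the closed epigraph, hence closed.\<close>

lemma borel_measurable_closed_fun:
  assumes "closed_fun f"
  shows "f \<in> borel_measurable borel"
  unfolding borel_measurable_iff_Iic_ereal
proof
  fix a :: ereal
  have closed: "closed {x. f x \<le> ereal r}" for r
  proof -
    have "closed ((\<lambda>x. (x, r)) -` epigraph_e f)"
      using assms unfolding closed_fun_def by (rule closed_vimage) (intro continuous_intros)
    also have "(\<lambda>x. (x, r)) -` epigraph_e f = {x. f x \<le> ereal r}"
      by (auto simp: epigraph_e_def)
    finally show ?thesis .
  qed
  \<comment> \<open>For \<open>a = \<infinity>\<close> the index set is empty and the intersection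
    is the whole space.\<close>
  have "f -` {..a} = (\<Inter>r\<in>{r. a \<le> ereal r}. {x. f x \<le> ereal r})"
    by (auto intro: order_trans ereal_le_real)
  moreover have "closed \<dots>" by (intro closed_INT ballI closed)
  ultimately show "f -` {..a} \<inter> space borel \<in> sets borel" by (simp add: borel_closed)
qed

text \<open>Strict sublevel sets of an infimum are unions of those of its members, here open by
  continuity in \<open>x\<close>; so the uncountable infimum does no harm.\<close>

lemma borel_measurable_MY_env:
  fixes f :: "'a::real_normed_vector \<Rightarrow> ereal"
  assumes "proper_fun f"
  shows "MY_env f lam \<in> borel_measurable borel"
proof (rule borel_measurableI_less)
  fix a :: ereal
  have "open {x. f y + ereal ((norm (y - x))\<^sup>2 / (2 * lam)) < a}" for y
  proof (cases "f y")
    case (real r)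
    have "continuous_on UNIV (\<lambda>x. ereal (r + (norm (y - x))\<^sup>2 / (2 * lam)))"
      unfolding divide_inverse by (intro continuous_intros)
    then have "open {x. ereal (r + (norm (y - x))\<^sup>2 / (2 * lam)) < a}"
      by (intro open_Collect_less continuous_on_const)
    then show ?thesis using real by simp
  qed (use assms in \<open>auto simp: proper_fun_def\<close>)
  then have "open (\<Union>y. {x. f y + ereal ((norm (y - x))\<^sup>2 / (2 * lam)) < a})" by blast
  also have "\<dots> = {x \<in> space borel. MY_env f lam x < a}"
    by (auto simp: MY_env_def INF_less_iff)
  finally show "{x \<in> space borel. MY_env f lam x < a} \<in> sets borel" by (rule borel_open)
qed

lemma MY_env_finite:
  assumes "proper_fun f" "bounded_below_fun f" "lam > 0"
  shows "\<bar>MY_env f lam x\<bar> \<noteq> \<infinity>"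
proof -
  obtain c where c: "\<And>x. ereal c \<le> f x" using assms by (auto simp: bounded_below_fun_def)
  obtain y where y: "f y \<noteq> \<infinity>" using assms by (auto simp: proper_fun_def)
  have "ereal c \<le> MY_env f lam x"
    unfolding MY_env_def
  proof (rule INF_greatest)
    fix y
    have "ereal c + 0 \<le> f y + ereal ((norm (y - x))\<^sup>2 / (2 * lam))"
      using c assms(3) by (intro add_mono) auto
    then show "ereal c \<le> f y + ereal ((norm (y - x))\<^sup>2 / (2 * lam))" by simp
  qed
  moreover have "MY_env f lam x \<le> f y + ereal ((norm (y - x))\<^sup>2 / (2 * lam))"
    unfolding MY_env_def by (rule INF_lower) simp
  then have "MY_env f lam x < \<infinity>"
    by (rule le_less_trans) (use y in \<open>cases "f y"; simp\<close>)
  ultimately show ?thesis by auto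
qed

section \<open>Gibbs measures and importance reweighting\<close>

lemma neg_exp_nonneg [simp]: "0 \<le> neg_exp f x"
  by (simp add: neg_exp_def)

lemma neg_exp_measurable [measurable]:
  assumes [measurable]: "f \<in> borel_measurable N"
  shows "neg_exp f \<in> borel_measurable N"
  unfolding neg_exp_def[abs_def] by measurable

lemma w_MY_measurable [measurable]:
  assumes [measurable]: "f \<in> borel_measurable borel" "MY_env f lam \<in> borel_measurable borel"
  shows "w_MY f lam \<in> borel_measurable borel"
  unfolding w_MY_def[abs_def] by measurable

lemma neg_exp_MY_env_mult_w_MY:
  assumes "proper_fun f" "bounded_below_fun f" "lam > 0"
  shows "neg_exp (MY_env f lam) x * w_MY f lam x = neg_exp f x"
  using MY_env_finite[OF assms, of x] by (auto simp: neg_exp_def w_MY_def exp_add[symmetric])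

lemma sets_gibbs [measurable_cong, simp]: "sets (gibbs f) = sets borel"
  by (simp add: gibbs_def)

lemma norm_const_nonneg: "0 \<le> norm_const f"
  by (simp add: norm_const_def)

lemma prob_space_gibbs:
  assumes [measurable]: "f \<in> borel_measurable borel" and "norm_const f \<noteq> 0"
  shows "prob_space (gibbs f)"
proof
  let ?I = "\<integral>\<^sup>+ x. ennreal (neg_exp f x) \<partial>lborel"
  have pos: "norm_const f > 0" using assms norm_const_nonneg[of f] by linarith
  \<comment> \<open>A nonzero value of \<open>enn2real\<close> excludes an infinite
    integral.\<close>
  have fin: "?I = ennreal (norm_const f)"
    using pos by (auto simp: norm_const_def enn2real_positive_iff less_top)
  have "emeasure (gibbs f) (space (gibbs f)) = (\<integral>\<^sup>+ x. ennreal (neg_exp f x / norm_const f) \<partial>lborel)"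
    by (simp add: gibbs_def emeasure_density)
  also have "\<dots> = (\<integral>\<^sup>+ x. ennreal (neg_exp f x) / ennreal (norm_const f) \<partial>lborel)"
    using pos by (intro nn_integral_cong divide_ennreal[symmetric]) auto
  also have "\<dots> = 1"
    using pos by (subst nn_integral_divide) (simp_all add: fin ennreal_divide_self)
  finally show "emeasure (gibbs f) (space (gibbs f)) = 1" .
qed

text \<open>Finiteness of the normalizing constant of \<open>\<psi>\<^sup>\<lambda>\<close> need not be derived from convexity: if the
  integral is infinite, \<open>enn2real\<close> returns \<open>0\<close>, and division by \<open>0\<close> makes \<open>gibbs\<close> the null measure.\<close>

lemma norm_const_neq_0_if_integral_neq_0:
  assumes "(\<integral>x. h x \<partial>gibbs f) \<noteq> (0::real)"
  shows "norm_const f \<noteq> 0"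
proof
  assume "norm_const f = 0"
  then have "gibbs f = density lborel (\<lambda>_. 0)" by (simp add: gibbs_def)
  then have "gibbs f = null_measure lborel" by (simp add: null_measure_eq_density)
  then show False using assms by simp
qed

text \<open>The weight turns one unnormalized density into the other, leaving only the ratio of
  normalizing constants, which cancels in the self-normalized estimator.\<close>

lemma gibbs_reweight:
  fixes h :: "'a::euclidean_space \<Rightarrow> real"
  assumes f: "proper_fun f" "bounded_below_fun f" "lam > 0" and [measurable]: "f \<in> borel_measurable borel"
    and nz: "norm_const f \<noteq> 0" "norm_const (MY_env f lam) \<noteq> 0"
    and h [measurable]: "h \<in> borel_measurable borel"
  shows "integrable (gibbs (MY_env f lam)) (\<lambda>x. h x * w_MY f lam x) \<longleftrightarrow> integrable (gibbs f) h" (is ?int)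
    and "(\<integral>x. h x * w_MY f lam x \<partial>gibbs (MY_env f lam))
      = norm_const f / norm_const (MY_env f lam) * (\<integral>x. h x \<partial>gibbs f)" (is ?eq)
proof -
  note [measurable] = borel_measurable_MY_env[OF f(1)]
  let ?c = "norm_const f / norm_const (MY_env f lam)"
  have eq: "neg_exp (MY_env f lam) x / norm_const (MY_env f lam) * (h x * w_MY f lam x)
      = ?c * (neg_exp f x / norm_const f * h x)" for x
    using nz by (simp add: neg_exp_MY_env_mult_w_MY[OF f, symmetric])
  have "integrable (gibbs (MY_env f lam)) (\<lambda>x. h x * w_MY f lam x)
      \<longleftrightarrow> integrable lborel (\<lambda>x. (neg_exp (MY_env f lam) x / norm_const (MY_env f lam)) *\<^sub>R (h x * w_MY f lam x))"
    unfolding gibbs_def by (rule integrable_density) (auto simp: norm_const_nonneg)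
  also have "\<dots> \<longleftrightarrow> integrable lborel (\<lambda>x. (neg_exp f x / norm_const f) *\<^sub>R h x)"
    unfolding real_scaleR_def eq using nz by (subst integrable_mult_left_iff) simp
  also have "\<dots> \<longleftrightarrow> integrable (gibbs f) h"
    unfolding gibbs_def by (rule integrable_density[symmetric]) (auto simp: norm_const_nonneg)
  finally show ?int .
  have "(\<integral>x. h x * w_MY f lam x \<partial>gibbs (MY_env f lam))
      = (\<integral>x. (neg_exp (MY_env f lam) x / norm_const (MY_env f lam)) *\<^sub>R (h x * w_MY f lam x) \<partial>lborel)"
    unfolding gibbs_def by (rule integral_density) (auto simp: norm_const_nonneg)
  also have "\<dots> = ?c * (\<integral>x. (neg_exp f x / norm_const f) *\<^sub>R h x \<partial>lborel)"
    unfolding real_scaleR_def eq by (rule integral_mult_right_zero)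
  also have "(\<integral>x. (neg_exp f x / norm_const f) *\<^sub>R h x \<partial>lborel) = (\<integral>x. h x \<partial>gibbs f)"
    unfolding gibbs_def by (rule integral_density[symmetric]) (auto simp: norm_const_nonneg)
  finally show ?eq .
qed

text \<open>Each entry is a finite sum of products of entries of the arguments, divided by a square
  with nonzero limit.\<close>

lemma tendsto_Xi_mat:
  assumes m: "(m \<longlongrightarrow> m0) F" "m0 \<noteq> 0" and th: "(\<theta> \<longlongrightarrow> \<theta>0) F" and S: "(S \<longlongrightarrow> S0) F"
  shows "((\<lambda>n. Xi_mat (m n) (\<theta> n) (S n)) \<longlongrightarrow> Xi_mat m0 \<theta>0 S0) F"
proof -
  have B: "((\<lambda>n. B_mat (\<theta> n) $ i $ j) \<longlongrightarrow> B_mat \<theta>0 $ i $ j) F" for i j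
    by (cases j) (auto simp: B_mat_def intro!: tendsto_intros th)
  have "((\<lambda>n. Xi_mat (m n) (\<theta> n) (S n) $ i $ j) \<longlongrightarrow> Xi_mat m0 \<theta>0 S0 $ i $ j) F" for i j
    unfolding Xi_mat_def matrix_matrix_mult_def transpose_def vector_scaleR_component vec_lambda_beta real_scaleR_def
    by (intro tendsto_intros B m S) (use m(2) in auto)
  then show ?thesis by (intro vec_tendstoI)
qed

section \<open>Almost sure consistency of the plug-in estimator\<close>

theorem theorem8:
  fixes \<psi> :: "real^'d \<Rightarrow> ereal" and lam :: real
    and \<xi> :: "real^'d \<Rightarrow> real^'p"
    and M :: "'w measure" and K :: "real^'d \<Rightarrow> (real^'d) measure"
    and X :: "nat \<Rightarrow> 'w \<Rightarrow> real^'d"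
    and est :: "nat \<Rightarrow> (real^'d) list \<Rightarrow> real^('p + unit)^('p + unit)"
  assumes psi: "proper_fun \<psi>" "closed_fun \<psi>" "convex_fun \<psi>" "bounded_below_fun \<psi>"
    and int_psi: "(\<integral>\<^sup>+ x. ennreal (neg_exp \<psi> x) \<partial>lborel) < \<infinity>"
    and int_pos: "(\<integral>\<^sup>+ x. ennreal (neg_exp \<psi> x) \<partial>lborel) > 0"
    and lam: "lam > 0"
    and xi_int: "integrable (gibbs \<psi>) \<xi>"
    and chain: "markov_chain M K X"
    and irr: "irreducible_kernel K" and aper: "aperiodic_kernel K"
    and harris: "harris_recurrent K"
    and stat: "gibbs (MY_env \<psi> lam) \<bind> K = gibbs (MY_env \<psi> lam)"
    and wd: "Xi_well_defined (gibbs (MY_env \<psi> lam)) K (S_vec \<xi> (w_MY \<psi> lam)) (w_MY \<psi> lam)"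
    and consistent: "AE \<omega> in M. (\<lambda>n. est n (map (\<lambda>t. X t \<omega>) [1..<Suc n]))
        \<longlonglongrightarrow> Sigma_mat (gibbs (MY_env \<psi> lam)) K (S_vec \<xi> (w_MY \<psi> lam))"
  shows "AE \<omega> in M.
     (\<lambda>n. let wbar = (\<Sum>t=1..n. w_MY \<psi> lam (X t \<omega>)) / real n;
              thetahat = (1 / (\<Sum>k=1..n. w_MY \<psi> lam (X k \<omega>))) *\<^sub>R
                           (\<Sum>t=1..n. w_MY \<psi> lam (X t \<omega>) *\<^sub>R \<xi> (X t \<omega>))
          in Xi_mat wbar thetahat (est n (map (\<lambda>t. X t \<omega>) [1..<Suc n])))
     \<longlonglongrightarrow> Xi_mat (\<integral>x. w_MY \<psi> lam x \<partial>gibbs (MY_env \<psi> lam))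
               (\<integral>x. \<xi> x \<partial>gibbs \<psi>)
               (Sigma_mat (gibbs (MY_env \<psi> lam)) K (S_vec \<xi> (w_MY \<psi> lam)))"
proof -
  let ?mu = "gibbs (MY_env \<psi> lam)" and ?w = "w_MY \<psi> lam"
  define m where "m = (\<integral>x. ?w x \<partial>?mu)"
  define r where "r = norm_const \<psi> / norm_const (MY_env \<psi> lam)"
  have w_int: "integrable ?mu ?w" and m_nz: "m \<noteq> 0"
    using wd by (auto simp: Xi_well_defined_def m_def)
  have psi_meas [measurable]: "\<psi> \<in> borel_measurable borel"
    by (rule borel_measurable_closed_fun[OF psi(2)])
  have env_meas [measurable]: "MY_env \<psi> lam \<in> borel_measurable borel"
    by (rule borel_measurable_MY_env[OF psi(1)])
  \<comment> \<open>The nonzero mean weight contained in \<open>wd\<close> excludes a degenerate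
    \<open>gibbs (MY_env \<psi> lam)\<close>.\<close>
  have nz: "norm_const \<psi> \<noteq> 0" "norm_const (MY_env \<psi> lam) \<noteq> 0"
    using int_psi int_pos norm_const_neq_0_if_integral_neq_0 m_nz
    by (auto simp: norm_const_def enn2real_eq_0_iff m_def)
  have prob: "prob_space ?mu" by (rule prob_space_gibbs[OF env_meas nz(2)])
  interpret pi: prob_space "gibbs \<psi>" by (rule prob_space_gibbs[OF psi_meas nz(1)])
  note reweight = gibbs_reweight[OF psi(1,4) lam psi_meas nz]
  note slln = harris_strong_law[OF chain harris prob sets_gibbs stat]
  have [measurable]: "\<xi> \<in> borel_measurable borel"
    using borel_measurable_integrable[OF xi_int] by (simp add: measurable_cong_sets[OF sets_gibbs refl])
  \<comment> \<open>Reweighting the constant 1 identifies the mean weight with the ratio of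
    normalizing constants.\<close>
  have m_eq: "m = r"
    using reweight(2)[of "\<lambda>_. 1"] by (simp add: m_def r_def pi.prob_space)
  have "AE \<omega> in M. (\<lambda>n. (\<Sum>t=1..n. ?w (X t \<omega>)) / real n) \<longlonglongrightarrow> m"
    unfolding m_def by (rule slln[OF _ w_int]) measurable
  moreover have "AE \<omega> in M. \<forall>i. (\<lambda>n. (\<Sum>t=1..n. \<xi> (X t \<omega>) $ i * ?w (X t \<omega>)) / real n)
      \<longlonglongrightarrow> m * (\<integral>x. \<xi> x \<partial>gibbs \<psi>) $ i"
  proof (subst AE_all_countable, intro allI)
    fix i
    have xi_i: "integrable (gibbs \<psi>) (\<lambda>x. \<xi> x $ i)"
      by (rule integrable_bounded_linear[OF bounded_linear_vec_nth xi_int])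
    have "(\<integral>x. \<xi> x $ i \<partial>gibbs \<psi>) = (\<integral>x. \<xi> x \<partial>gibbs \<psi>) $ i"
      by (rule integral_bounded_linear[OF bounded_linear_vec_nth xi_int])
    then show "AE \<omega> in M. (\<lambda>n. (\<Sum>t=1..n. \<xi> (X t \<omega>) $ i * ?w (X t \<omega>)) / real n)
        \<longlonglongrightarrow> m * (\<integral>x. \<xi> x \<partial>gibbs \<psi>) $ i"
      using slln[of "\<lambda>x. \<xi> x $ i * ?w x"] reweight[of "\<lambda>x. \<xi> x $ i"] xi_i
      by (simp add: m_eq r_def)
  qed
  ultimately show ?thesis
    using consistent
  proof eventually_elim
    case (elim \<omega>)
    let ?th = "\<lambda>n. (1 / (\<Sum>k=1..n. ?w (X k \<omega>))) *\<^sub>R (\<Sum>t=1..n. ?w (X t \<omega>) *\<^sub>R \<xi> (X t \<omega>))"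
    have "?th \<longlonglongrightarrow> (\<integral>x. \<xi> x \<partial>gibbs \<psi>)"
    proof (rule vec_tendstoI)
      fix i
      have "(\<lambda>n. ((\<Sum>t=1..n. \<xi> (X t \<omega>) $ i * ?w (X t \<omega>)) / real n) / ((\<Sum>t=1..n. ?w (X t \<omega>)) / real n))
          \<longlonglongrightarrow> m * (\<integral>x. \<xi> x \<partial>gibbs \<psi>) $ i / m"
        by (rule tendsto_divide[OF elim(2)[rule_format, of i] elim(1) m_nz])
      \<comment> \<open>The two factors \<open>1 / n\<close> cancel once
        \<open>n > 0\<close>.\<close>
      moreover have "\<forall>\<^sub>F n in sequentially.
          ((\<Sum>t=1..n. \<xi> (X t \<omega>) $ i * ?w (X t \<omega>)) / real n) / ((\<Sum>t=1..n. ?w (X t \<omega>)) / real n) = ?th n $ i"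
        using eventually_gt_at_top[of 0]
        by eventually_elim (simp add: sum_component mult.commute)
      ultimately have "(\<lambda>n. ?th n $ i) \<longlonglongrightarrow> m * (\<integral>x. \<xi> x \<partial>gibbs \<psi>) $ i / m"
        by (rule Lim_transform_eventually)
      then show "(\<lambda>n. ?th n $ i) \<longlonglongrightarrow> (\<integral>x. \<xi> x \<partial>gibbs \<psi>) $ i"
        by (simp only: nonzero_mult_div_cancel_left[OF m_nz])
    qed
    then show ?case
      unfolding Let_def using elim(1,3) m_nz
      by (intro tendsto_Xi_mat) (auto simp: m_def)
  qed
qed

end
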